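(* Let $k\ge 0$ be an integer and let $u\in\mathcal{C}^k(B(0,1))$, written in polar coordinates as $u(r,\phi)$. Then the Zernike coefficients $A_{nm}$, $B_{nm}$ of $u$ decay at the rate of $m^{-k}$; that is, there exists a constant $C>0$ (depending on $u$ and $k$, but not on $n,m$) such that $$|A_{nm}|\le C\,m^{-k}\quad\text{and}\quad |B_{nm}|\le C\,m^{-k}$$ for all integers $n\ge m\ge 1$ with $n-m$ even.
   Context: $B(0,1)=\{(x,y)\in\mathbb{R}^2 : x^2+y^2\le 1\}$ is the closed unit disk, with polar coordinates $x=r\cos\phi$, $y=r\sin\phi$, $0\le r\le 1$, $0\le\phi\le 2\pi$. $\mathcal{C}^k(B(0,1))$ is the space of (real- or complex-valued) functions on $B(0,1)$ whose partial derivatives (with respect to $x,y$) up to order $k$ all exist and are continuous on $B(0,1)$ (at the boundary: the derivatives in the interior extend continuously to the closed disk). For integers $n\ge m\ge 0$ with $n-m$ even, the radial part of the Zernike polynomial is $$R_n^m(r)=\sum_{\ell=0}^{(n-m)/2}(-1)^\ell\frac{(n-\ell)!}{\ell!\,\left(\frac{n-m}{2}-\ell\right)!\,\left(\frac{n+m}{2}-\ell\right)!}\,r^{n-2\ell}.$$ Let $\epsilon_0=1$ and $\epsilon_m=2$ for $m\ge1$. The inner product on the unit disk is $\langle f,g\rangle=\int_0^1\int_0^{2\pi} f(r,\phi)\,\overline{g(r,\phi)}\,r\,d\phi\,dr$. The normalized Zernike polynomials are $${}^e\underline{U}_n^m(r,\phi)=\sqrt{\tfrac{\epsilon_m(n+1)}{\pi}}\,R_n^m(r)\cos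 m\phi,\qquad {}^o\underline{U}_n^m(r,\phi)=\sqrt{\tfrac{\epsilon_m(n+1)}{\pi}}\,R_n^m(r)\sin m\phi .$$ The Zernike coefficients of a function $f$ on the unit disk are $$A_{nm}=\langle f,{}^e\underline{U}_n^m\rangle,\qquad B_{nm}=\langle f,{}^o\underline{U}_n^m\rangle .$$ *)

theory Defs
  imports "HOL-Analysis.Analysis"
begin

definition closed_disk :: "(real \<times> real) set" where
  "closed_disk = {(x, y). x\<^sup>2 + y\<^sup>2 \<le> 1}"

definition open_disk :: "(real \<times> real) set" where
  "open_disk = {(x, y). x\<^sup>2 + y\<^sup>2 < 1}"

text \<open>
  \<open>Ck_disk k\<close> is the space \<open>C^k(B(0,1))\<close>: the witnesses \<open>ux\<close> and \<open>uy\<close> are the partial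
  derivatives of \<open>u\<close> in the open disk, extended to the closed disk. The extension is
  required to be continuous by the recursive condition, as membership at any order
  includes continuity on the closed disk. Only the values of \<open>u\<close> on the closed disk matter.
  Real-valued functions are included through the embedding \<^term>\<open>complex_of_real\<close>.
\<close>
primrec Ck_disk :: "nat \<Rightarrow> (real \<times> real \<Rightarrow> complex) \<Rightarrow> bool" where
  "Ck_disk 0 u \<longleftrightarrow> continuous_on closed_disk u"
| "Ck_disk (Suc k) u \<longleftrightarrow> continuous_on closed_disk u \<and>
     (\<exists>ux uy. Ck_disk k ux \<and> Ck_disk k uy \<and>
       (\<forall>(x, y) \<in> open_disk.
          ((\<lambda>t. u (t, y)) has_vector_derivative ux (x, y)) (at x) \<and>
          ((\<lambda>t. u (x, t)) has_vector_derivative uy (x, y)) (at y)))"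

definition polar :: "(real \<times> real \<Rightarrow> complex) \<Rightarrow> real \<Rightarrow> real \<Rightarrow> complex" where
  "polar u r \<phi> = u (r * cos \<phi>, r * sin \<phi>)"

text \<open>Meaningful for \<open>n \<ge> m\<close> with \<open>n - m\<close> even; then all subtractions and divisions on
  naturals below are exact.\<close>
definition zernike_radial :: "nat \<Rightarrow> nat \<Rightarrow> real \<Rightarrow> real" where
  "zernike_radial n m r =
     (\<Sum>l = 0..(n - m) div 2.
        (-1) ^ l * (fact (n - l) /
          (fact l * fact ((n - m) div 2 - l) * fact ((n + m) div 2 - l))) * r ^ (n - 2 * l))"

definition neumann_factor :: "nat \<Rightarrow> real" where
  "neumann_factor m = (if m = 0 then 1 else 2)"

definition zernike_even :: "nat \<Rightarrow> nat \<Rightarrow> real \<Rightarrow> real \<Rightarrow> real" where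
  "zernike_even n m r \<phi> =
     sqrt (neumann_factor m * (real n + 1) / pi) * zernike_radial n m r * cos (real m * \<phi>)"

definition zernike_odd :: "nat \<Rightarrow> nat \<Rightarrow> real \<Rightarrow> real \<Rightarrow> real" where
  "zernike_odd n m r \<phi> =
     sqrt (neumann_factor m * (real n + 1) / pi) * zernike_radial n m r * sin (real m * \<phi>)"

text \<open>The arguments are functions of the polar coordinates.\<close>
definition disk_inner :: "(real \<Rightarrow> real \<Rightarrow> complex) \<Rightarrow> (real \<Rightarrow> real \<Rightarrow> complex) \<Rightarrow> complex" where
  "disk_inner f g =
     integral {0..1} (\<lambda>r. integral {0..2 * pi} (\<lambda>\<phi>. f r \<phi> * cnj (g r \<phi>) * complex_of_real r))"

definition zernike_coeff_A :: "(real \<times> real \<Rightarrow> complex) \<Rightarrow> nat \<Rightarrow> nat \<Rightarrow> complex" where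
  "zernike_coeff_A u n m =
     disk_inner (polar u) (\<lambda>r \<phi>. complex_of_real (zernike_even n m r \<phi>))"

definition zernike_coeff_B :: "(real \<times> real \<Rightarrow> complex) \<Rightarrow> nat \<Rightarrow> nat \<Rightarrow> complex" where
  "zernike_coeff_B u n m =
     disk_inner (polar u) (\<lambda>r \<phi>. complex_of_real (zernike_odd n m r \<phi>))"

end

theory Submission
  imports Defs "HOL-Computational_Algebra.Polynomial"
begin

text \<open>
  In polar coordinates a Zernike coefficient is a Fourier integral in the angle followed by an
  integral against the radial polynomial, and the two can be estimated separately.

  The angular derivative is \<open>x \<partial>/\<partial>y - y \<partial>/\<partial>x\<close>. It maps \<open>C^(k+1)\<close> of the disk to \<open>C^k\<close>, so \<open>k\<close>
  integrations by parts over the circle of radius \<open>r\<close> bound the \<open>m\<close>-th Fourier integral by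
  \<open>C / m^k\<close>, with the same \<open>C\<close> for all radii (\<open>angular_coeff_decay\<close>).

  The normalization of the Zernike polynomials grows like \<open>sqrt (n + 1)\<close>. It is compensated by
  the exact value \<open>1 / (2 (n + 1))\<close> of the integral of \<open>R\<^sup>2\<close> against \<open>r dr\<close>
  (\<open>zernike_radial_norm\<close>), which follows from Rodrigues' formula for Jacobi polynomials: by the
  Cauchy-Schwarz inequality the integral of \<open>\<bar>R\<bar>\<close> against the same weight is at most \<open>1 / (2 sqrt (n + 1))\<close>
  (\<open>zernike_inner_bound\<close>). The resulting constant thus depends neither on \<open>n\<close> nor on \<open>m\<close>.
\<close>

section \<open>Normalization of the radial polynomials\<close>

text \<open>
  Integration over \<open>[0, 1]\<close> as a functional on polynomials, so that the integrations by parts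
  below become identities for the formal derivative.
\<close>

definition unit_integral :: "real poly \<Rightarrow> real" where
  "unit_integral q = integral {0..1} (poly q)"

lemma unit_integral_smult: "unit_integral (smult c q) = c * unit_integral q"
proof -
  have "poly (smult c q) = (\<lambda>x. c * poly q x)" by auto
  thus ?thesis by (simp add: unit_integral_def)
qed

lemma unit_integral_add: "unit_integral (p + q) = unit_integral p + unit_integral q"
proof -
  have "poly (p + q) = (\<lambda>x. poly p x + poly q x)" by auto
  thus ?thesis unfolding unit_integral_def
    by (simp add: integral_add integrable_continuous_interval continuous_intros)
qed

lemma unit_integral_pderiv: "unit_integral (pderiv q) = poly q 1 - poly q 0"
proof -
  have "(poly (pderiv q) has_integral (poly q 1 - poly q 0)) {0..1}"
    by (intro fundamental_theorem_of_calculus)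
       (auto simp: has_real_derivative_iff_has_vector_derivative[symmetric]
             intro: DERIV_subset[OF poly_DERIV])
  thus ?thesis by (simp add: unit_integral_def integral_unique)
qed

lemma unit_integral_by_parts:
  assumes "poly F 0 = 0" "poly F 1 = 0"
  shows "unit_integral (pderiv F * G) = - unit_integral (F * pderiv G)"
  using unit_integral_pderiv[of "F * G"] assms
  by (simp add: pderiv_mult unit_integral_add mult.commute)

text \<open>
  This moves all the derivatives in a Rodrigues formula onto the other factor.
\<close>

lemma unit_integral_by_parts_iterated:
  assumes "\<And>i. i < p \<Longrightarrow> poly ((pderiv ^^ i) F) 0 = 0"
    and "\<And>i. i < p \<Longrightarrow> poly ((pderiv ^^ i) F) 1 = 0"
  shows "unit_integral ((pderiv ^^ p) F * G) = (-1) ^ p * unit_integral (F * (pderiv ^^ p) G)"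
  using assms
proof (induction p arbitrary: G)
  case (Suc p)
  have "unit_integral ((pderiv ^^ Suc p) F * G) = - unit_integral ((pderiv ^^ p) F * pderiv G)"
    using Suc.prems by (simp add: unit_integral_by_parts)
  also have "\<dots> = - ((-1) ^ p * unit_integral (F * (pderiv ^^ p) (pderiv G)))"
    using Suc by simp
  also have "(pderiv ^^ p) (pderiv G) = (pderiv ^^ Suc p) G"
    by (simp add: funpow_swap1)
  finally show ?case by simp
qed simp

lemma power_dvd_pderiv:
  fixes q :: "real poly"
  assumes "q ^ Suc n dvd F"
  shows "q ^ n dvd pderiv F"
proof -
  obtain G where "F = q ^ Suc n * G" using assms by (elim dvdE)
  hence "pderiv F = q ^ n * (q * pderiv G + G * smult (of_nat (Suc n)) (pderiv q))"
    by (simp only: pderiv_mult pderiv_power_Suc) (simp add: algebra_simps)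
  thus ?thesis by simp
qed

lemma power_dvd_higher_pderiv:
  fixes q :: "real poly"
  shows "q ^ (i + n) dvd F \<Longrightarrow> q ^ n dvd (pderiv ^^ i) F"
proof (induction i arbitrary: n)
  case (Suc i)
  have "q ^ Suc n dvd (pderiv ^^ i) F" using Suc.IH[of "Suc n"] Suc.prems by simp
  thus ?case using power_dvd_pderiv by (simp del: power_Suc)
qed simp

text \<open>
  A zero of order \<open>n\<close> makes the boundary terms in \<open>n\<close> integrations by parts vanish.
\<close>

lemma poly_higher_pderiv_eq_0:
  fixes a :: real
  assumes "[:-a, 1:] ^ n dvd F" "i < n"
  shows "poly ((pderiv ^^ i) F) a = 0"
proof -
  have "[:-a, 1:] ^ (i + 1) dvd F"
    using assms by (metis dvd_trans le_imp_power_dvd Suc_leI Suc_eq_plus1)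
  hence "[:-a, 1:] ^ 1 dvd (pderiv ^^ i) F" by (rule power_dvd_higher_pderiv)
  thus ?thesis by (simp add: poly_eq_0_iff_dvd)
qed

text \<open>
  The Beta integral with integer exponents; the sign comes from writing \<open>t - 1\<close> instead of
  \<open>1 - t\<close>. Raising one exponent while lowering the other is again an integration by parts.
\<close>

lemma unit_integral_beta:
  "unit_integral (monom 1 a * [:-1, 1:] ^ b) = (-1) ^ b * fact a * fact b / fact (a + b + 1)"
proof (induction b arbitrary: a)
  case 0
  have "unit_integral (pderiv (monom (1 / (real a + 1)) (Suc a))) = 1 / (real a + 1)"
    by (simp only: unit_integral_pderiv) (simp add: poly_monom)
  also have "pderiv (monom (1 / (real a + 1)) (Suc a)) = monom 1 a"
    by (simp add: pderiv_monom add.commute add_eq_0_iff)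
  finally show ?case by simp
next
  case (Suc b)
  have solve: "x = - y / \<alpha>" if "\<alpha> * x + y = 0" "\<alpha> \<noteq> 0" for x y \<alpha> :: real
  proof -
    have "x * \<alpha> = - y" using that by (simp add: eq_neg_iff_add_eq_0 mult.commute)
    thus ?thesis using that(2) by (metis nonzero_mult_div_cancel_right)
  qed
  let ?H = "monom 1 (Suc a) * [:-1, 1:] ^ Suc b :: real poly"
  have "pderiv ?H = smult (real (Suc a)) (monom 1 a * [:-1, 1:] ^ Suc b)
      + smult (real (Suc b)) (monom 1 (Suc a) * [:-1, 1:] ^ b)"
  proof -
    have "monom (real (Suc a)) a = smult (real (Suc a)) (monom 1 a)"
      by (simp add: smult_monom)
    hence "pderiv (monom 1 (Suc a)) = smult (real (Suc a)) (monom 1 a)"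
      by (simp add: pderiv_monom)
    moreover have "pderiv [:-1, 1::real:] = 1" by (simp add: pderiv_pCons)
    ultimately show ?thesis
      by (simp only: pderiv_mult pderiv_power_Suc mult_smult_left mult_smult_right mult_1_left mult_1_right
            add.commute mult.commute)
  qed
  hence "real (Suc a) * unit_integral (monom 1 a * [:-1, 1:] ^ Suc b)
      + real (Suc b) * unit_integral (monom 1 (Suc a) * [:-1, 1:] ^ b) = 0"
    using unit_integral_pderiv[of ?H]
    by (simp only: unit_integral_add unit_integral_smult) (simp add: poly_monom)
  hence "unit_integral (monom 1 a * [:-1, 1:] ^ Suc b)
      = - (real (Suc b) * ((-1) ^ b * fact (Suc a) * fact b / fact (Suc a + b + 1))) / real (Suc a)"
    unfolding Suc.IH by (intro solve) simp_all
  also have "\<dots> = (-1) ^ Suc b * fact a * fact (Suc b) / fact (a + Suc b + 1)"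
    by (simp add: divide_simps) 
  finally show ?case .
qed

lemma higher_pderiv_monom_real:
  "(pderiv ^^ p) (monom c (p + j)) = monom (c * fact (p + j) / fact j) j" for c :: real
proof (induction p arbitrary: c)
  case (Suc p)
  have "(pderiv ^^ Suc p) (monom c (Suc p + j)) = (pderiv ^^ p) (pderiv (monom c (Suc (p + j))))"
    by (simp only: funpow_Suc_right o_apply add_Suc)
  also have "\<dots> = monom (real (Suc (p + j)) * c * fact (p + j) / fact j) j"
    by (simp only: pderiv_monom diff_Suc_1 Suc.IH)
  finally show ?case by (simp add: mult_ac)
qed simp

text \<open>
  With \<open>n = m + 2p\<close>, the radial part is \<open>r^m P(r\<^sup>2)\<close> for a polynomial \<open>P\<close> of degree \<open>p\<close>. This \<open>P\<close>
  is the Jacobi polynomial with parameters \<open>(0, m)\<close>, transplanted to \<open>[0, 1]\<close>; it is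
  orthogonal with respect to the weight \<open>t^m\<close>.
\<close>

definition jacobi_coeff :: "nat \<Rightarrow> nat \<Rightarrow> nat \<Rightarrow> real" where
  "jacobi_coeff p m l =
     (-1) ^ l * (fact (m + 2 * p - l) / (fact l * fact (p - l) * fact (m + p - l)))"

definition jacobi_poly :: "nat \<Rightarrow> nat \<Rightarrow> real poly" where
  "jacobi_poly p m = (\<Sum>l\<le>p. monom (jacobi_coeff p m l) (p - l))"

lemma zernike_radial_conv_jacobi:
  "zernike_radial (m + 2 * p) m r = r ^ m * poly (jacobi_poly p m) (r\<^sup>2)"
proof -
  have "r ^ (m + 2 * p - 2 * l) = r ^ m * (r\<^sup>2) ^ (p - l)" if "l \<le> p" for l
  proof -
    have "m + 2 * p - 2 * l = m + 2 * (p - l)" using that by simp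
    thus ?thesis by (simp only: power_add power_mult)
  qed
  moreover have "(m + 2 * p + m) div 2 = m + p" by simp
  ultimately show ?thesis
    unfolding zernike_radial_def jacobi_poly_def jacobi_coeff_def poly_sum poly_monom
      sum_distrib_left atMost_atLeast0
    by (intro sum.cong) (simp_all add: add.commute)
qed

text \<open>
  Rodrigues' formula. Expanding \<open>(t - 1)^p\<close> binomially, the \<open>p\<close>-fold derivative turns the
  binomial coefficients into the quotients of factorials of the radial polynomial.
\<close>

lemma jacobi_rodrigues:
  "(pderiv ^^ p) (monom 1 (m + p) * [:-1, 1:] ^ p) = smult (fact p) (monom 1 m * jacobi_poly p m)"
proof -
  have expand: "monom 1 (m + p) * [:-1, 1:] ^ p
      = (\<Sum>l\<le>p. monom ((-1) ^ l * real (p choose l)) (p + (m + p - l)))"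
  proof (rule poly_ext)
    fix x :: real
    have "poly (monom 1 (m + p) * [:-1, 1:] ^ p) x
        = (\<Sum>l\<le>p. x ^ (m + p) * (real (p choose l) * (-1) ^ l * x ^ (p - l)))"
      using binomial_ring[of "-1::real" x p]
      by (simp add: poly_monom sum_distrib_left)
    also have "\<dots> = (\<Sum>l\<le>p. (-1) ^ l * real (p choose l) * x ^ (p + (m + p - l)))"
    proof (rule sum.cong)
      fix l assume "l \<in> {..p}"
      hence "p + (m + p - l) = (m + p) + (p - l)" by simp
      thus "x ^ (m + p) * (real (p choose l) * (-1) ^ l * x ^ (p - l))
          = (-1) ^ l * real (p choose l) * x ^ (p + (m + p - l))"
        by (simp only: power_add mult_ac)
    qed simp
    finally show "poly (monom 1 (m + p) * [:-1, 1:] ^ p) x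
        = poly (\<Sum>l\<le>p. monom ((-1) ^ l * real (p choose l)) (p + (m + p - l))) x"
      by (simp add: poly_sum poly_monom)
  qed
  have "(pderiv ^^ p) (monom 1 (m + p) * [:-1, 1:] ^ p)
      = (\<Sum>l\<le>p. monom ((-1) ^ l * real (p choose l) * fact (p + (m + p - l)) / fact (m + p - l))
                  (m + p - l))"
    unfolding expand higher_pderiv_sum higher_pderiv_monom_real ..
  also have "\<dots> = (\<Sum>l\<le>p. smult (fact p) (monom 1 m * monom (jacobi_coeff p m l) (p - l)))"
  proof (rule sum.cong)
    fix l assume "l \<in> {..p}"
    hence l: "l \<le> p" by simp
    have "p + (m + p - l) = m + 2 * p - l" "m + p - l = m + (p - l)" using l by simp_all
    moreover have "real (p choose l) = fact p / (fact l * fact (p - l))"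
      by (rule binomial_fact[OF l])
    ultimately show "monom ((-1) ^ l * real (p choose l) * fact (p + (m + p - l)) / fact (m + p - l))
          (m + p - l) = smult (fact p) (monom 1 m * monom (jacobi_coeff p m l) (p - l))"
      by (simp add: mult_monom smult_monom jacobi_coeff_def)
  qed simp
  also have "\<dots> = smult (fact p) (monom 1 m * jacobi_poly p m)"
    by (rule poly_ext) (simp add: jacobi_poly_def poly_sum sum_distrib_left)
  finally show ?thesis .
qed

lemma higher_pderiv_jacobi:
  "(pderiv ^^ p) (jacobi_poly p m) = [: fact (m + 2 * p) / fact (m + p) :]"
proof -
  have "(pderiv ^^ p) (monom c (p - l)) = (if l = 0 then [: c * fact p :] else 0)"
    if "l \<le> p" for l and c :: real
  proof (cases "l = 0")
    case True
    thus ?thesis using higher_pderiv_monom_real[of p c 0] by (simp add: monom_0)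
  next
    case False
    then obtain d where "l = Suc d" by (cases l) auto
    with that have d: "p = Suc d + (p - l)" by simp
    have "(pderiv ^^ p) (monom c (p - l)) = (pderiv ^^ Suc d) ((pderiv ^^ (p - l)) (monom c (p - l)))"
      using funpow_add[of "Suc d" "p - l" pderiv] d by (metis comp_apply)
    also have "(pderiv ^^ (p - l)) (monom c (p - l)) = [: c * fact (p - l) :]"
      using higher_pderiv_monom_real[of "p - l" c 0] by (simp add: monom_0)
    finally show ?thesis
      using False by (simp add: funpow_swap1 pderiv_pCons)
  qed
  hence "(pderiv ^^ p) (jacobi_poly p m)
      = (\<Sum>l\<le>p. if l = 0 then [: jacobi_coeff p m 0 * fact p :] else 0)"
    unfolding jacobi_poly_def higher_pderiv_sum by (intro sum.cong) auto
  thus ?thesis by (simp add: jacobi_coeff_def)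
qed

text \<open>
  Rodrigues' formula represents \<open>t^m P\<close> as a \<open>p\<close>-fold derivative. Moved onto the second factor
  \<open>P\<close>, these derivatives leave only its leading coefficient times \<open>p!\<close>, and the remaining
  integral is a Beta integral.
\<close>

lemma jacobi_norm:
  "unit_integral (monom 1 m * (jacobi_poly p m)\<^sup>2) = 1 / (real m + 2 * real p + 1)"
proof -
  let ?F = "monom 1 (m + p) * [:-1, 1:] ^ p :: real poly"
  have "[:-0, 1:] ^ p dvd ?F"
    by (simp add: monom_altdef power_add)
  moreover have "[:-1, 1:] ^ p dvd ?F" by simp
  ultimately have "unit_integral ((pderiv ^^ p) ?F * jacobi_poly p m)
      = (-1) ^ p * unit_integral (?F * (pderiv ^^ p) (jacobi_poly p m))"
    by (intro unit_integral_by_parts_iterated poly_higher_pderiv_eq_0)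
  hence "fact p * unit_integral (monom 1 m * (jacobi_poly p m)\<^sup>2)
      = (-1) ^ p * (fact (m + 2 * p) / fact (m + p) * unit_integral ?F)"
    by (simp add: jacobi_rodrigues higher_pderiv_jacobi unit_integral_smult power2_eq_square mult_ac)
  also have "\<dots> = fact (m + 2 * p) * fact p / fact (Suc (m + 2 * p))"
    unfolding unit_integral_beta by (simp add: mult_2 add_ac flip: power_mult_distrib del: fact_Suc)
  also have "\<dots> = fact p * (1 / (real m + 2 * real p + 1))"
    by (simp add: add_ac)
  finally show ?thesis by (subst (asm) mult_left_cancel) simp_all
qed

text \<open>
  The substitution \<open>t = r\<^sup>2\<close> carries the area weight \<open>r dr\<close> to \<open>dt / 2\<close>.
\<close>

lemma zernike_radial_norm:
  assumes "m \<le> n" "even (n - m)"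
  shows "((\<lambda>r. (zernike_radial n m r)\<^sup>2 * r) has_integral 1 / (2 * (real n + 1))) {0..1}"
proof -
  obtain p where n: "n = m + 2 * p" using assms by (metis dvdE le_add_diff_inverse)
  define Q where "Q = monom 1 m * (jacobi_poly p m)\<^sup>2"
  have "((\<lambda>r. (2 * r) *\<^sub>R poly Q (r\<^sup>2)) has_integral integral {0\<^sup>2..1\<^sup>2} (poly Q)) {0..1::real}"
    by (rule has_integral_substitution[where c = 0 and d = 1])
       (auto intro!: continuous_intros derivative_eq_intros simp: power_le_one)
  hence "((\<lambda>r. (1 / 2) * ((2 * r) *\<^sub>R poly Q (r\<^sup>2))) has_integral (1 / 2) * unit_integral Q) {0..1}"
    by (intro has_integral_mult_right) (simp add: unit_integral_def)
  moreover have "(\<lambda>r. (1 / 2) * ((2 * r) *\<^sub>R poly Q (r\<^sup>2)) ) = (\<lambda>r. (zernike_radial n m r)\<^sup>2 * r)"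
  proof
    fix r :: real
    have "zernike_radial n m r = r ^ m * poly (jacobi_poly p m) (r\<^sup>2)"
      unfolding n by (rule zernike_radial_conv_jacobi)
    thus "(1 / 2) * ((2 * r) *\<^sub>R poly Q (r\<^sup>2)) = (zernike_radial n m r)\<^sup>2 * r"
      by (simp add: Q_def poly_monom power_mult_distrib mult_ac flip: power_mult)
  qed
  moreover have "(1 / 2) * unit_integral Q = 1 / (2 * (real n + 1))"
    by (simp add: Q_def jacobi_norm n)
  ultimately show ?thesis by (simp only:)
qed
section \<open>Angular differentiation on the disk\<close>

lemma closed_disk_eq_cball: "closed_disk = cball 0 1"
  by (auto simp: closed_disk_def norm_Pair)

lemma open_disk_eq_ball: "open_disk = ball 0 1"
  by (auto simp: open_disk_def norm_Pair)

lemma open_disk_subset: "open_disk \<subseteq> closed_disk"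
  by (auto simp: open_disk_def closed_disk_def)

lemma polar_point_closed: "0 \<le> r \<Longrightarrow> r \<le> 1 \<Longrightarrow> (r * cos \<phi>, r * sin \<phi>) \<in> closed_disk"
  and polar_point_open: "0 \<le> r \<Longrightarrow> r < 1 \<Longrightarrow> (r * cos \<phi>, r * sin \<phi>) \<in> open_disk"
  by (simp_all add: closed_disk_def open_disk_def power_mult_distrib power_le_one
        power_less_one_iff abs_square_less_1 flip: distrib_left)

lemma Ck_disk_continuous: "Ck_disk k u \<Longrightarrow> continuous_on closed_disk u"
  by (cases k) auto

lemma Ck_disk_SucI:
  assumes "continuous_on closed_disk u" "Ck_disk k ux" "Ck_disk k uy"
    and "\<And>x y. (x, y) \<in> open_disk \<Longrightarrow> ((\<lambda>t. u (t, y)) has_vector_derivative ux (x, y)) (at x)"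
    and "\<And>x y. (x, y) \<in> open_disk \<Longrightarrow> ((\<lambda>t. u (x, t)) has_vector_derivative uy (x, y)) (at y)"
  shows "Ck_disk (Suc k) u"
proof -
  have "\<forall>(x, y) \<in> open_disk.
      ((\<lambda>t. u (t, y)) has_vector_derivative ux (x, y)) (at x) \<and>
      ((\<lambda>t. u (x, t)) has_vector_derivative uy (x, y)) (at y)"
    using assms(4,5) by auto
  with assms(1-3) show ?thesis unfolding Ck_disk.simps by blast
qed

lemma Ck_disk_SucE:
  assumes "Ck_disk (Suc k) u"
  obtains ux uy where "Ck_disk k ux" "Ck_disk k uy"
    and "\<And>x y. (x, y) \<in> open_disk \<Longrightarrow> ((\<lambda>t. u (t, y)) has_vector_derivative ux (x, y)) (at x)"
    and "\<And>x y. (x, y) \<in> open_disk \<Longrightarrow> ((\<lambda>t. u (x, t)) has_vector_derivative uy (x, y)) (at y)"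
proof -
  obtain ux uy where "Ck_disk k ux" "Ck_disk k uy" and
    "\<forall>(x, y) \<in> open_disk.
          ((\<lambda>t. u (t, y)) has_vector_derivative ux (x, y)) (at x) \<and>
          ((\<lambda>t. u (x, t)) has_vector_derivative uy (x, y)) (at y)"
    using assms unfolding Ck_disk.simps by blast
  thus ?thesis by (intro that[of ux uy]) auto
qed

lemma Ck_disk_decrease: "Ck_disk (Suc k) u \<Longrightarrow> Ck_disk k u"
proof (induction k arbitrary: u)
  case 0
  thus ?case by simp
next
  case (Suc k)
  from Suc.prems obtain ux uy where "Ck_disk (Suc k) ux" "Ck_disk (Suc k) uy"
    and "\<And>x y. (x, y) \<in> open_disk \<Longrightarrow> ((\<lambda>t. u (t, y)) has_vector_derivative ux (x, y)) (at x)"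
    and "\<And>x y. (x, y) \<in> open_disk \<Longrightarrow> ((\<lambda>t. u (x, t)) has_vector_derivative uy (x, y)) (at y)"
    by (rule Ck_disk_SucE) blast
  thus ?case by (intro Ck_disk_SucI[of u k ux uy] Suc.IH Ck_disk_continuous[OF Suc.prems])
qed

text \<open>
  The angular derivative multiplies partial derivatives by the coordinate functions, so it
  stays within the scale of spaces \<open>C^k\<close> because each of them is an algebra
  that contains the coordinates. This is what the next lemmas establish.
\<close>

lemma Ck_disk_const: "Ck_disk k (\<lambda>p. c)"
proof (induction k arbitrary: c)
  case (Suc k)
  show ?case by (rule Ck_disk_SucI[OF _ Suc[of 0] Suc[of 0]]) simp_all
qed simp

lemma Ck_disk_fst: "Ck_disk k (\<lambda>p. of_real (fst p))"
proof (cases k)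
  case (Suc j)
  have "((\<lambda>t::real. complex_of_real t) has_vector_derivative 1) (at x)" for x
    using has_vector_derivative_of_real[OF DERIV_ident] by simp
  thus ?thesis unfolding Suc
    by (intro Ck_disk_SucI[OF _ Ck_disk_const[of j 1] Ck_disk_const[of j 0]])
       (auto intro!: continuous_intros)
qed (auto intro!: continuous_intros)

lemma Ck_disk_snd: "Ck_disk k (\<lambda>p. of_real (snd p))"
proof (cases k)
  case (Suc j)
  have "((\<lambda>t::real. complex_of_real t) has_vector_derivative 1) (at x)" for x
    using has_vector_derivative_of_real[OF DERIV_ident] by simp
  thus ?thesis unfolding Suc
    by (intro Ck_disk_SucI[OF _ Ck_disk_const[of j 0] Ck_disk_const[of j 1]])
       (auto intro!: continuous_intros)
qed (auto intro!: continuous_intros)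

lemma Ck_disk_add:
  "Ck_disk k u \<Longrightarrow> Ck_disk k v \<Longrightarrow> Ck_disk k (\<lambda>p. u p + v p)"
proof (induction k arbitrary: u v)
  case 0
  thus ?case by (auto intro: continuous_intros)
next
  case (Suc k)
  obtain ux uy where u: "Ck_disk k ux" "Ck_disk k uy"
    "\<And>x y. (x, y) \<in> open_disk \<Longrightarrow> ((\<lambda>t. u (t, y)) has_vector_derivative ux (x, y)) (at x)"
    "\<And>x y. (x, y) \<in> open_disk \<Longrightarrow> ((\<lambda>t. u (x, t)) has_vector_derivative uy (x, y)) (at y)"
    using Suc.prems(1) by (rule Ck_disk_SucE) blast
  obtain vx vy where v: "Ck_disk k vx" "Ck_disk k vy"
    "\<And>x y. (x, y) \<in> open_disk \<Longrightarrow> ((\<lambda>t. v (t, y)) has_vector_derivative vx (x, y)) (at x)"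
    "\<And>x y. (x, y) \<in> open_disk \<Longrightarrow> ((\<lambda>t. v (x, t)) has_vector_derivative vy (x, y)) (at y)"
    using Suc.prems(2) by (rule Ck_disk_SucE) blast
  show ?case
  proof (rule Ck_disk_SucI)
    show "continuous_on closed_disk (\<lambda>p. u p + v p)"
      by (intro continuous_intros Suc.prems[THEN Ck_disk_continuous])
    show "Ck_disk k (\<lambda>p. ux p + vx p)" "Ck_disk k (\<lambda>p. uy p + vy p)"
      by (intro Suc.IH u v)+
  qed (auto intro!: has_vector_derivative_add u v)
qed

lemma Ck_disk_mult:
  "Ck_disk k u \<Longrightarrow> Ck_disk k v \<Longrightarrow> Ck_disk k (\<lambda>p. u p * v p)"
proof (induction k arbitrary: u v)
  case 0
  thus ?case by (auto intro: continuous_intros)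
next
  case (Suc k)
  obtain ux uy where u: "Ck_disk k ux" "Ck_disk k uy"
    "\<And>x y. (x, y) \<in> open_disk \<Longrightarrow> ((\<lambda>t. u (t, y)) has_vector_derivative ux (x, y)) (at x)"
    "\<And>x y. (x, y) \<in> open_disk \<Longrightarrow> ((\<lambda>t. u (x, t)) has_vector_derivative uy (x, y)) (at y)"
    using Suc.prems(1) by (rule Ck_disk_SucE) blast
  obtain vx vy where v: "Ck_disk k vx" "Ck_disk k vy"
    "\<And>x y. (x, y) \<in> open_disk \<Longrightarrow> ((\<lambda>t. v (t, y)) has_vector_derivative vx (x, y)) (at x)"
    "\<And>x y. (x, y) \<in> open_disk \<Longrightarrow> ((\<lambda>t. v (x, t)) has_vector_derivative vy (x, y)) (at y)"
    using Suc.prems(2) by (rule Ck_disk_SucE) blast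
  show ?case
  proof (rule Ck_disk_SucI)
    show "continuous_on closed_disk (\<lambda>p. u p * v p)"
      by (intro continuous_intros Suc.prems[THEN Ck_disk_continuous])
    show "Ck_disk k (\<lambda>p. u p * vx p + ux p * v p)" "Ck_disk k (\<lambda>p. u p * vy p + uy p * v p)"
      by (intro Ck_disk_add Suc.IH u v Suc.prems[THEN Ck_disk_decrease])+
  qed (auto intro!: has_vector_derivative_mult u v)
qed

text \<open>
  One-variable derivatives along the axes do not give a chain rule; total differentiability
  does, and for it the continuity of one of the two partial derivatives is enough.
  The criterion is applied on a product of sets with a convex second factor, hence the
  passage to a product neighbourhood.
\<close>

lemma has_derivative_of_continuous_partials:
  fixes u ux uy :: "real \<times> real \<Rightarrow> complex"
  assumes "open S" "(x, y) \<in> S" "continuous_on S uy"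
    and ux: "((\<lambda>t. u (t, y)) has_vector_derivative ux (x, y)) (at x)"
    and uy: "\<And>x y. (x, y) \<in> S \<Longrightarrow> ((\<lambda>t. u (x, t)) has_vector_derivative uy (x, y)) (at y)"
  shows "(u has_derivative (\<lambda>(s, t). s *\<^sub>R ux (x, y) + t *\<^sub>R uy (x, y))) (at (x, y))"
proof -
  obtain A B where AB: "open A" "open B" "(x, y) \<in> A \<times> B" "A \<times> B \<subseteq> S"
    using assms(1,2) by (rule open_prod_elim)
  then obtain e where e: "e > 0" "ball y e \<subseteq> B" by (auto elim: openE)
  define Y where "Y = ball y e"
  have Y: "open Y" "convex Y" "y \<in> Y" "A \<times> Y \<subseteq> S" using e AB by (auto simp: Y_def)
  have "((\<lambda>(s, t). u (s, t)) has_derivative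
          (\<lambda>(s, t). s *\<^sub>R ux (x, y) + blinfun_apply (blinfun_scaleR_left (uy (x, y))) t))
        (at (x, y) within A \<times> Y)"
  proof (rule has_derivative_partialsI[where fy = "\<lambda>x y. blinfun_scaleR_left (uy (x, y))"])
    show "((\<lambda>s. u (s, y)) has_derivative (\<lambda>s. s *\<^sub>R ux (x, y))) (at x within A)"
      using ux unfolding has_vector_derivative_def by (rule has_derivative_at_withinI)
    show "((\<lambda>t. u (s, t)) has_derivative blinfun_apply (blinfun_scaleR_left (uy (s, t))))
          (at t within Y)" if "s \<in> A" "t \<in> Y" for s t
      using uy[of s t] that Y(4) unfolding has_vector_derivative_def
      by (auto intro: has_derivative_at_withinI)
    have "isCont uy (x, y)"
      using assms(1-3) by (auto simp: continuous_on_eq_continuous_at)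
    hence "isCont (\<lambda>p. blinfun_scaleR_left (uy p)) (x, y)"
      by (intro continuous_intros bounded_linear.continuous[OF bounded_linear_blinfun_scaleR_left])
    thus "continuous (at (x, y) within A \<times> Y) (\<lambda>(x, y). blinfun_scaleR_left (uy (x, y)))"
      by (simp add: continuous_at_imp_continuous_at_within case_prod_beta')
  qed (use Y in auto)
  moreover have "at (x, y) within A \<times> Y = at (x, y)"
    using AB Y by (intro at_within_open open_Times) auto
  ultimately show ?thesis by (simp add: case_prod_beta')
qed

text \<open>
  In polar coordinates \<open>\<partial>/\<partial>\<phi> = x \<partial>/\<partial>y - y \<partial>/\<partial>x\<close>, a vector field with smooth coefficients on
  the whole disk. Only \<open>r < 1\<close> is possible at this point, since the derivatives
  of \<open>u\<close> on the boundary circle are mere continuous extensions.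
\<close>

lemma Ck_disk_angular_derivative:
  assumes "Ck_disk (Suc k) u"
  obtains v where "Ck_disk k v"
    and "\<And>r \<phi>. 0 \<le> r \<Longrightarrow> r < 1 \<Longrightarrow> (polar u r has_vector_derivative polar v r \<phi>) (at \<phi>)"
proof -
  obtain ux uy where u: "Ck_disk k ux" "Ck_disk k uy"
    "\<And>x y. (x, y) \<in> open_disk \<Longrightarrow> ((\<lambda>t. u (t, y)) has_vector_derivative ux (x, y)) (at x)"
    "\<And>x y. (x, y) \<in> open_disk \<Longrightarrow> ((\<lambda>t. u (x, t)) has_vector_derivative uy (x, y)) (at y)"
    using assms by (rule Ck_disk_SucE) blast
  define v where "v = (\<lambda>p. (-1) * (of_real (snd p) * ux p) + of_real (fst p) * uy p)"
  show ?thesis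
  proof
    show "Ck_disk k v" unfolding v_def
      by (intro Ck_disk_add Ck_disk_mult Ck_disk_const Ck_disk_fst Ck_disk_snd u)
    fix r \<phi> :: real assume r: "0 \<le> r" "r < 1"
    let ?p = "\<lambda>\<phi>. (r * cos \<phi>, r * sin \<phi>)"
    have "(u has_derivative (\<lambda>(s, t). s *\<^sub>R ux (?p \<phi>) + t *\<^sub>R uy (?p \<phi>))) (at (?p \<phi>))"
      using u polar_point_open[OF r] Ck_disk_continuous[OF u(2)] open_disk_subset
      by (intro has_derivative_of_continuous_partials[where S = open_disk])
         (auto simp: open_disk_eq_ball intro: continuous_on_subset)
    hence "(u has_derivative (\<lambda>(s, t). s *\<^sub>R ux (?p \<phi>) + t *\<^sub>R uy (?p \<phi>)))
             (at (?p \<phi>) within range ?p)"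
      by (rule has_derivative_at_withinI)
    moreover have "(?p has_vector_derivative (- r * sin \<phi>, r * cos \<phi>)) (at \<phi>)"
      by (intro has_vector_derivative_Pair)
         (auto intro!: derivative_eq_intros simp flip: has_real_derivative_iff_has_vector_derivative)
    ultimately have "((u \<circ> ?p) has_vector_derivative
        (\<lambda>(s, t). s *\<^sub>R ux (?p \<phi>) + t *\<^sub>R uy (?p \<phi>)) (- r * sin \<phi>, r * cos \<phi>)) (at \<phi>)"
      by (intro vector_derivative_diff_chain_within[where S = UNIV])
    thus "(polar u r has_vector_derivative polar v r \<phi>) (at \<phi>)"
      by (simp add: polar_def[abs_def] v_def o_def scaleR_conv_of_real)
  qed
qed

section \<open>Decay of the angular Fourier integrals\<close>

lemma continuous_on_polar:
  assumes "continuous_on closed_disk u"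
  shows "continuous_on ({0..1} \<times> S) (\<lambda>(r, \<phi>). polar u r \<phi>)"
proof -
  have "continuous_on ({0..1} \<times> S) (\<lambda>p. u (fst p * cos (snd p), fst p * sin (snd p)))"
    by (rule continuous_on_compose2[OF assms])
       (auto intro!: continuous_intros polar_point_closed)
  thus ?thesis by (simp add: polar_def case_prod_beta')
qed

lemma continuous_on_polar_angle:
  assumes "continuous_on closed_disk u" "0 \<le> r" "r \<le> 1"
  shows "continuous_on S (polar u r)"
proof -
  have "continuous_on S (\<lambda>\<phi>. (\<lambda>(r, \<phi>). polar u r \<phi>) (r, \<phi>))"
    by (rule continuous_on_compose2[OF continuous_on_polar[OF assms(1), of S]])
       (use assms in \<open>auto intro!: continuous_intros\<close>)
  thus ?thesis by simp
qed

text \<open>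
  The phase \<open>c\<close> lets one family of integrals serve for cosine and sine, and makes it closed
  under integration by parts, which shifts the phase by a quarter turn.
\<close>

definition angular_coeff :: "(real \<times> real \<Rightarrow> complex) \<Rightarrow> nat \<Rightarrow> real \<Rightarrow> real \<Rightarrow> complex" where
  "angular_coeff u m c r = integral {0..2 * pi} (\<lambda>\<phi>. polar u r \<phi> * of_real (cos (real m * \<phi> + c)))"

lemma continuous_on_angular_coeff:
  assumes "continuous_on closed_disk u"
  shows "continuous_on {0..1} (angular_coeff u m c)"
proof -
  have "continuous_on ({0..1} \<times> cbox 0 (2 * pi))
          (\<lambda>(r, \<phi>). polar u r \<phi> * of_real (cos (real m * \<phi> + c)))"
    unfolding case_prod_beta'
    by (intro continuous_intros continuous_on_polar[OF assms, unfolded case_prod_beta'])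
  from integral_continuous_on_param[OF this] show ?thesis
    by (simp add: angular_coeff_def[abs_def])
qed

text \<open>
  Integration by parts over a full period: the boundary terms cancel by periodicity, which
  is where the integrality of \<open>m\<close> enters.
\<close>

lemma angular_coeff_derivative:
  assumes u: "continuous_on closed_disk u" and v: "continuous_on closed_disk v"
    and r: "0 \<le> r" "r < 1"
    and deriv: "\<And>\<phi>. (polar u r has_vector_derivative polar v r \<phi>) (at \<phi>)"
  shows "of_nat m * angular_coeff u m c r = angular_coeff v m (c + pi / 2) r"
proof -
  let ?H = "\<lambda>\<phi>. polar u r \<phi> * of_real (sin (real m * \<phi> + c))"
  let ?f = "\<lambda>\<phi>. polar u r \<phi> * of_real (cos (real m * \<phi> + c))"
  let ?g = "\<lambda>\<phi>. polar v r \<phi> * of_real (cos (real m * \<phi> + (c + pi / 2)))"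
  have cont: "continuous_on {0..2 * pi} (polar u r)" "continuous_on {0..2 * pi} (polar v r)"
    using u v r by (auto intro: continuous_on_polar_angle)
  have shift: "cos (real m * \<phi> + (c + pi / 2)) = - sin (real m * \<phi> + c)" for \<phi>
    using minus_sin_cos_eq[of "real m * \<phi> + c"] by (simp add: add.assoc)
  have trig: "((\<lambda>\<phi>. complex_of_real (sin (real m * \<phi> + c))) has_vector_derivative
          of_real (real m * cos (real m * \<phi> + c))) (at \<phi>)" for \<phi>
    by (intro has_vector_derivative_of_real)
       (auto intro!: derivative_eq_intros simp flip: has_real_derivative_iff_has_vector_derivative)
  have "(?H has_vector_derivative (of_nat m * ?f \<phi> - ?g \<phi>)) (at \<phi>)" for \<phi>
    unfolding shift using has_vector_derivative_mult[OF deriv[of \<phi>] trig[of \<phi>]]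
    by (simp add: mult_ac)
  hence "((\<lambda>\<phi>. of_nat m * ?f \<phi> - ?g \<phi>) has_integral (?H (2 * pi) - ?H 0)) {0..2 * pi}"
    by (intro fundamental_theorem_of_calculus) (auto intro: has_vector_derivative_at_within)
  moreover have "?H (2 * pi) = ?H 0"
    using sin.plus_of_nat[of c m]
    by (simp add: polar_def mult.commute add.commute)
  ultimately have "integral {0..2 * pi} (\<lambda>\<phi>. of_nat m * ?f \<phi> - ?g \<phi>) = 0"
    by (simp add: integral_unique)
  also have "integral {0..2 * pi} (\<lambda>\<phi>. of_nat m * ?f \<phi> - ?g \<phi>)
      = of_nat m * angular_coeff u m c r - angular_coeff v m (c + pi / 2) r"
    unfolding angular_coeff_def
    by (subst integral_diff)
       (auto intro!: integrable_continuous_interval continuous_intros cont)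
  finally show ?thesis by simp
qed

text \<open>
  Each derivative gains a factor \<open>1/m\<close>, and the last one is bounded by compactness of the
  closed disk. The bound is uniform in \<open>r\<close> because every iterated angular derivative is again
  continuous on the closed disk.
\<close>

lemma angular_coeff_decay_open:
  assumes "Ck_disk k u"
  shows "\<exists>C\<ge>0. \<forall>m c r. 1 \<le> m \<longrightarrow> 0 \<le> r \<longrightarrow> r < 1 \<longrightarrow> cmod (angular_coeff u m c r) \<le> C / real m ^ k"
  using assms
proof (induction k arbitrary: u)
  case 0
  hence cont: "continuous_on closed_disk u" by simp
  have "bounded (u ` closed_disk)"
    using cont compact_cball unfolding closed_disk_eq_cball
    by (intro compact_imp_bounded compact_continuous_image)
  then obtain B where "\<forall>z\<in>u ` closed_disk. cmod z \<le> B"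
    unfolding bounded_iff ..
  hence B: "cmod (u p) \<le> \<bar>B\<bar>" if "p \<in> closed_disk" for p
    using that by (meson abs_ge_self imageI order_trans)
  have "cmod (angular_coeff u m c r) \<le> \<bar>B\<bar> * (2 * pi - 0)" if "0 \<le> r" "r < 1" for m c r
    unfolding angular_coeff_def
  proof (rule integral_bound)
    show "continuous_on {0..2 * pi} (\<lambda>\<phi>. polar u r \<phi> * of_real (cos (real m * \<phi> + c)))"
      using that cont by (intro continuous_intros continuous_on_polar_angle) auto
    fix \<phi>
    have "cmod (polar u r \<phi>) * \<bar>cos (real m * \<phi> + c)\<bar> \<le> \<bar>B\<bar> * 1"
      using that by (intro mult_mono) (auto simp: polar_def intro!: B polar_point_closed)
    thus "cmod (polar u r \<phi> * of_real (cos (real m * \<phi> + c))) \<le> \<bar>B\<bar>"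
      by (simp add: norm_mult)
  qed auto
  thus ?case by (intro exI[of _ "\<bar>B\<bar> * (2 * pi - 0)"]) auto
next
  case (Suc k)
  obtain v where v: "Ck_disk k v"
    and deriv: "\<And>r \<phi>. 0 \<le> r \<Longrightarrow> r < 1 \<Longrightarrow> (polar u r has_vector_derivative polar v r \<phi>) (at \<phi>)"
    using Suc.prems by (rule Ck_disk_angular_derivative) blast
  obtain C where C: "C \<ge> 0"
    "\<And>m c r. 1 \<le> m \<Longrightarrow> 0 \<le> r \<Longrightarrow> r < 1 \<Longrightarrow> cmod (angular_coeff v m c r) \<le> C / real m ^ k"
    using Suc.IH[OF v] by blast
  have "cmod (angular_coeff u m c r) \<le> C / real m ^ Suc k" if "1 \<le> m" "0 \<le> r" "r < 1" for m c r
  proof -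
    have "of_nat m * angular_coeff u m c r = angular_coeff v m (c + pi / 2) r"
      using that deriv Suc.prems v
      by (intro angular_coeff_derivative) (auto dest: Ck_disk_continuous)
    hence "real m * cmod (angular_coeff u m c r) = cmod (angular_coeff v m (c + pi / 2) r)"
      by (metis norm_mult norm_of_nat)
    also have "\<dots> \<le> C / real m ^ k" using that by (intro C)
    finally show ?thesis using that(1) by (simp add: field_simps)
  qed
  with C(1) show ?case by blast
qed

text \<open>
  The boundary circle \<open>r = 1\<close> is reached by continuity in \<open>r\<close>.
\<close>

lemma angular_coeff_decay:
  assumes "Ck_disk k u"
  obtains C where "C \<ge> 0"
    "\<And>m c r. 1 \<le> m \<Longrightarrow> 0 \<le> r \<Longrightarrow> r \<le> 1 \<Longrightarrow> cmod (angular_coeff u m c r) \<le> C / real m ^ k"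
proof -
  obtain C where C: "C \<ge> 0"
    "\<And>m c r. 1 \<le> m \<Longrightarrow> 0 \<le> r \<Longrightarrow> r < 1 \<Longrightarrow> cmod (angular_coeff u m c r) \<le> C / real m ^ k"
    using angular_coeff_decay_open[OF assms] by blast
  show ?thesis
  proof
    fix m c r assume "1 \<le> (m::nat)" "0 \<le> (r::real)" "r \<le> 1"
    thus "cmod (angular_coeff u m c r) \<le> C / real m ^ k"
      using C continuous_on_angular_coeff[OF Ck_disk_continuous[OF assms]]
      by (intro continuous_on_closure_norm_le[where s = "{0..<1}"]) auto
  qed (fact C)
qed

section \<open>Decay of the Zernike coefficients\<close>

lemma continuous_on_zernike_radial: "continuous_on S (zernike_radial n m)"
  unfolding zernike_radial_def by (intro continuous_intros)

text \<open>
  Once the angular integral is bounded by \<open>M\<close>, what remains is the weighted \<open>L\<^sup>1\<close> norm of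
  the radial polynomial. By Cauchy-Schwarz it is at most \<open>1 / (2 sqrt (n + 1))\<close>, a factor that
  will cancel the growth of the normalization. The inequality is used here in its pointwise
  form \<open>2\<bar>R\<bar> \<le> s R\<^sup>2 + 1/s\<close>, in which \<open>s = sqrt (n + 1)\<close> balances the integrals of both terms.
\<close>

lemma zernike_inner_bound:
  assumes u: "continuous_on closed_disk u" and nm: "m \<le> n" "even (n - m)"
    and M: "\<And>r. 0 \<le> r \<Longrightarrow> r \<le> 1 \<Longrightarrow> cmod (angular_coeff u m c r) \<le> M"
    and K: "K \<ge> 0"
  shows "cmod (disk_inner (polar u)
           (\<lambda>r \<phi>. of_real (K * zernike_radial n m r * cos (real m * \<phi> + c))))
         \<le> K * M / (2 * sqrt (real n + 1))"
proof -
  define s where "s = sqrt (real n + 1)"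
  have s: "s > 0" "s\<^sup>2 = real n + 1" by (simp_all add: s_def)
  let ?R = "zernike_radial n m"
  let ?h = "\<lambda>r. of_real (K * ?R r * r) * angular_coeff u m c r"
  have inner: "disk_inner (polar u) (\<lambda>r \<phi>. of_real (K * ?R r * cos (real m * \<phi> + c)))
      = integral {0..1} ?h"
    unfolding disk_inner_def angular_coeff_def
    by (simp only: integral_mult_right[symmetric] complex_cnj_mult complex_cnj_complex_of_real
          of_real_mult mult_ac)
  have majorant: "cmod (integral {0..1} ?h)
      \<le> integral {0..1} (\<lambda>r. K * M * (s / 2 * ((?R r)\<^sup>2 * r) + 1 / (2 * s) * r))"
  proof (rule integral_norm_bound_integral)
    show "?h integrable_on {0..1}"
      by (intro integrable_continuous_interval continuous_intros continuous_on_zernike_radial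
            continuous_on_angular_coeff u)
    show "(\<lambda>r. K * M * (s / 2 * ((?R r)\<^sup>2 * r) + 1 / (2 * s) * r)) integrable_on {0..1}"
      by (intro integrable_continuous_interval continuous_intros continuous_on_zernike_radial)
    fix r :: real assume r: "r \<in> {0..1}"
    \<comment> \<open>Expanding a square gives the pointwise form of Cauchy-Schwarz.\<close>
    have "0 \<le> (s * \<bar>?R r\<bar> - 1)\<^sup>2 / (2 * s)" using s by simp
    also have "\<dots> = s / 2 * (?R r)\<^sup>2 + 1 / (2 * s) - \<bar>?R r\<bar>"
      using s(1) by (simp add: field_simps power2_eq_square)
    finally have "\<bar>?R r\<bar> * r \<le> (s / 2 * (?R r)\<^sup>2 + 1 / (2 * s)) * r"
      using r by (intro mult_right_mono) auto
    moreover have "cmod (angular_coeff u m c r) \<le> M" using M r by simp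
    ultimately have "K * (\<bar>?R r\<bar> * r) * cmod (angular_coeff u m c r)
        \<le> K * ((s / 2 * (?R r)\<^sup>2 + 1 / (2 * s)) * r) * M"
      using K r s(1)
      by (intro mult_mono[OF mult_left_mono]) (auto intro!: mult_nonneg_nonneg add_nonneg_nonneg)
    thus "cmod (?h r) \<le> K * M * (s / 2 * ((?R r)\<^sup>2 * r) + 1 / (2 * s) * r)"
      using K r by (simp add: norm_mult abs_mult algebra_simps)
  qed
  have "((\<lambda>r. r) has_integral 1 / 2) {0..1::real}"
    using ident_has_integral[of 0 "1::real"] by simp
  hence "((\<lambda>r. K * M * (s / 2 * ((?R r)\<^sup>2 * r) + 1 / (2 * s) * r)) has_integral
      K * M * (s / 2 * (1 / (2 * (real n + 1))) + 1 / (2 * s) * (1 / 2))) {0..1}"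
    by (intro has_integral_mult_right has_integral_add zernike_radial_norm nm)
  also have "K * M * (s / 2 * (1 / (2 * (real n + 1))) + 1 / (2 * s) * (1 / 2)) = K * M / (2 * s)"
    unfolding s(2)[symmetric] using s(1) by (simp add: field_simps power2_eq_square)
  finally show ?thesis
    using majorant unfolding inner s_def by (simp only: integral_unique)
qed

theorem theorem4p1:
  fixes k :: nat and u :: "real \<times> real \<Rightarrow> complex"
  assumes "Ck_disk k u"
  shows "\<exists>C::real. C > 0 \<and>
           (\<forall>n m::nat. 1 \<le> m \<and> m \<le> n \<and> even (n - m) \<longrightarrow>
              cmod (zernike_coeff_A u n m) \<le> C * real m powi (- int k) \<and>
              cmod (zernike_coeff_B u n m) \<le> C * real m powi (- int k))"
proof -
  obtain C where C: "C \<ge> 0"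
    "\<And>m c r. 1 \<le> m \<Longrightarrow> 0 \<le> r \<Longrightarrow> r \<le> 1 \<Longrightarrow> cmod (angular_coeff u m c r) \<le> C / real m ^ k"
    using angular_coeff_decay[OF assms] by blast
  have "cmod (zernike_coeff_A u n m) \<le> (C + 1) * real m powi (- int k) \<and>
        cmod (zernike_coeff_B u n m) \<le> (C + 1) * real m powi (- int k)"
    if nm: "1 \<le> m" "m \<le> n" "even (n - m)" for n m
  proof -
    define K where "K = sqrt (neumann_factor m * (real n + 1) / pi)"
    have K: "K \<ge> 0" by (simp add: K_def neumann_factor_def)
    have A: "zernike_coeff_A u n m = disk_inner (polar u)
        (\<lambda>r \<phi>. of_real (K * zernike_radial n m r * cos (real m * \<phi> + 0)))"
      by (simp add: zernike_coeff_A_def zernike_even_def[abs_def] K_def)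
    have sin_eq: "sin (real m * \<phi>) = cos (real m * \<phi> + (- pi / 2))" for \<phi>
      by (simp add: cos_diff)
    have B: "zernike_coeff_B u n m = disk_inner (polar u)
        (\<lambda>r \<phi>. of_real (K * zernike_radial n m r * cos (real m * \<phi> + (- pi / 2))))"
      unfolding zernike_coeff_B_def zernike_odd_def[abs_def] K_def sin_eq ..
    \<comment> \<open>The normalization grows like the square root of \<open>n + 1\<close>, exactly as fast as the
       bound on the \<open>L\<^sup>1\<close> norm of the radial part decays.\<close>
    have "K = sqrt (2 / pi) * sqrt (real n + 1)"
      using nm by (simp add: K_def neumann_factor_def flip: real_sqrt_mult)
    also have "\<dots> \<le> 2 * sqrt (real n + 1)"
    proof (rule mult_right_mono)
      have "2 / pi \<le> 2\<^sup>2" using pi_gt3 by (simp add: field_simps)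
      thus "sqrt (2 / pi) \<le> 2" by (metis real_le_lsqrt zero_le_numeral)
    qed simp
    finally have "K / (2 * sqrt (real n + 1)) \<le> 1" by (simp add: divide_simps)
    hence "K / (2 * sqrt (real n + 1)) * (C / real m ^ k) \<le> 1 * (C / real m ^ k)"
      using C(1) by (intro mult_right_mono) auto
    hence "K * (C / real m ^ k) / (2 * sqrt (real n + 1)) \<le> C / real m ^ k"
      by (simp add: mult_ac)
    also have "\<dots> \<le> (C + 1) / real m ^ k"
      by (intro divide_right_mono) auto
    also have "\<dots> = (C + 1) * real m powi (- int k)"
      by (simp add: power_int_minus divide_inverse)
    finally have le: "K * (C / real m ^ k) / (2 * sqrt (real n + 1)) \<le> (C + 1) * real m powi (- int k)" .
    show ?thesis unfolding A B
      using nm K C(2) Ck_disk_continuous[OF assms]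
      by (intro conjI order_trans[OF zernike_inner_bound le]) auto
  qed
  \<comment> \<open>\<open>C\<close> itself may vanish, for instance for \<open>u = 0\<close>, but the constant has to be positive.\<close>
  with C(1) show ?thesis by (intro exI[of _ "C + 1"]) auto
qed

end
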